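(* Let $\mathcal{B}(G_{k,\ell})$ denote the set of bipolar orientations of the grid $G_{k,\ell}$ with source $(1,1)$ and sink $(k,\ell)$ if $k$ is odd, and with source $(1,1)$ and sink $(k,1)$ if $k$ is even. For $k,\ell$ big enough, $$2.18^{k\ell}\le|\mathcal{B}(G_{k,\ell})|\le 2.619^{k\ell}.$$
   Context: The grid graph $G_{k,\ell}$ has vertex set $\{(i,j): 1\le i\le k,\ 1\le j\le\ell\}$, horizontal edges $\{(i,j),(i,j+1)\}$ ($1\le i\le k$, $1\le j\le \ell-1$) and vertical edges $\{(i,j),(i+1,j)\}$ ($1\le i\le k-1$, $1\le j\le\ell$), with its standard plane embedding. A bipolar orientation of a connected graph with source $s$ and sink $t$ is an acyclic orientation of its edges in which $s$ is the only vertex without incoming edges and $t$ is the only vertex without outgoing edges ($s$ and $t$ need not be adjacent). *)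

theory Defs
  imports Complex_Main
begin

type_synonym 'a ugraph = "'a set \<times> 'a set set"

abbreviation verts :: "'a ugraph \<Rightarrow> 'a set" where
  "verts \<equiv> fst"

abbreviation edges :: "'a ugraph \<Rightarrow> 'a set set" where
  "edges \<equiv> snd"

text \<open>An arc \<open>(u, v)\<close> is directed from \<open>u\<close> to \<open>v\<close>. Bijectivity says that every edge
  receives exactly one of its two directions and that there are no further arcs.\<close>

definition is_orientation :: "'a ugraph \<Rightarrow> ('a \<times> 'a) set \<Rightarrow> bool" where
  "is_orientation G D \<longleftrightarrow> bij_betw (\<lambda>(u, v). {u, v}) D (edges G)"

definition sources :: "'a ugraph \<Rightarrow> ('a \<times> 'a) set \<Rightarrow> 'a set" where
  "sources G D = {v \<in> verts G. \<nexists>u. (u, v) \<in> D}"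

definition sinks :: "'a ugraph \<Rightarrow> ('a \<times> 'a) set \<Rightarrow> 'a set" where
  "sinks G D = {v \<in> verts G. \<nexists>w. (v, w) \<in> D}"

definition bipolar_orientation :: "'a ugraph \<Rightarrow> 'a \<Rightarrow> 'a \<Rightarrow> ('a \<times> 'a) set \<Rightarrow> bool" where
  "bipolar_orientation G s t D \<longleftrightarrow>
     is_orientation G D \<and> acyclic D \<and> sources G D = {s} \<and> sinks G D = {t}"

definition grid :: "nat \<Rightarrow> nat \<Rightarrow> (nat \<times> nat) ugraph" where
  "grid k l =
     ({(i, j). 1 \<le> i \<and> i \<le> k \<and> 1 \<le> j \<and> j \<le> l},
      {{(i, j), (i, j + 1)} | i j. 1 \<le> i \<and> i \<le> k \<and> 1 \<le> j \<and> j + 1 \<le> l} \<union>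
      {{(i, j), (i + 1, j)} | i j. 1 \<le> i \<and> i + 1 \<le> k \<and> 1 \<le> j \<and> j \<le> l})"

definition grid_sink :: "nat \<Rightarrow> nat \<Rightarrow> nat \<times> nat" where
  "grid_sink k l = (if odd k then (k, l) else (k, 1))"

definition grid_bipolar_orientations :: "nat \<Rightarrow> nat \<Rightarrow> ((nat \<times> nat) \<times> (nat \<times> nat)) set set" where
  "grid_bipolar_orientations k l = {D. bipolar_orientation (grid k l) (1, 1) (grid_sink k l) D}"

text \<open>The set to be counted is finite, so its \<^const>\<open>card\<close> is its true cardinality.\<close>

lemma finite_grid_bipolar_orientations: "finite (grid_bipolar_orientations k l)"
proof -
  let ?V = "{1..k} \<times> {1..l}"
  have "D \<subseteq> ?V \<times> ?V" if "is_orientation (grid k l) D" for D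
  proof
    fix a assume a: "a \<in> D"
    obtain u v where uv: "a = (u, v)" by (cases a)
    have "{u, v} \<in> edges (grid k l)"
      using that a unfolding is_orientation_def bij_betw_def uv by force
    then obtain i j i' j' where "{u, v} = {(i, j), (i', j')}" "{(i, j), (i', j')} \<subseteq> ?V"
      unfolding grid_def by fastforce
    then show "a \<in> ?V \<times> ?V"
      unfolding uv by (metis insert_subset mem_Sigma_iff)
  qed
  then have "grid_bipolar_orientations k l \<subseteq> Pow (?V \<times> ?V)"
    unfolding grid_bipolar_orientations_def bipolar_orientation_def by auto
  then show ?thesis
    by (rule finite_subset) simp
qed

end

theory Submission imports Defs begin

text \<open>
  Both bounds rest on the local structure of a bipolar orientation of the grid. Write one bit for each edge: whether a
  horizontal edge points right, whether a vertical edge points down. A double count of the angles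
  (\<open>bipolar_local_structure\<close>) shows that around every unit square, and around every interior vertex, the two horizontal
  edges are parallel or the two vertical edges are parallel. So squares and interior vertices obey the same rule,
  and the midpoints of the edges carry a configuration of the six-vertex model on a lattice with about \<open>2 k l\<close> sites.

  For the upper bound, such a configuration is read off one antidiagonal of edge midpoints at a time. Given the previous
  antidiagonals, each new bit is either forced or free, and a free bit has exactly one value after which the next bit is free
  as well. The number of ways to fill an antidiagonal therefore grows like the Fibonacci numbers (\<open>card_chains_le\<close>), and
  altogether there are at most \<open>x\<^sup>2\<close> configurations per grid vertex, for any \<open>x\<close> above the golden ratio, up to a factor
  exponential in \<open>k + l\<close> (\<open>ice_count\<close>). The square of the golden ratio is 2.61803...

  For the lower bound, all vertical edges point down at first and the horizontal edges are arbitrary, except that the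
  first row leads away from the source and the last row leads to the sink. Then any set of vertical edges whose
  four adjacent horizontal edges are parallel may be turned upwards. That this creates no directed cycle is seen on the
  plane dual: from every square one can leave the grid by crossing arcs from right to left only, and likewise from left to right,
  so a closed walk has winding number 0 around each square (\<open>winding_nonpos\<close>, \<open>acyclic_orient\<close>). A vertical edge
  can be turned with probability \<open>1 / 8\<close>, so by convexity (\<open>sum_power2_ge_power2_mean\<close>) this family has about
  \<open>2\<close> to the power \<open>(1 + 1 / 8) k l\<close> members (\<open>card_grid_lower\<close>), and \<open>2 powr (9 / 8)\<close> is 2.181...
\<close>

section \<open>Orientations as bit fields\<close>

definition h_edges :: "nat \<Rightarrow> nat \<Rightarrow> (nat \<times> nat) set" where
  "h_edges k l = {(i, j). 1 \<le> i \<and> i \<le> k \<and> 1 \<le> j \<and> j < l}"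

definition v_edges :: "nat \<Rightarrow> nat \<Rightarrow> (nat \<times> nat) set" where
  "v_edges k l = {(i, j). 1 \<le> i \<and> i < k \<and> 1 \<le> j \<and> j \<le> l}"

text \<open>Orientations are encoded by two bit fields: \<open>r i j\<close> says that the edge from \<open>(i, j)\<close> to \<open>(i, j + 1)\<close> points
right, \<open>d i j\<close> that the edge from \<open>(i, j)\<close> to \<open>(i + 1, j)\<close> points down (rows are numbered downwards).\<close>

definition orient :: "nat \<Rightarrow> nat \<Rightarrow> (nat \<Rightarrow> nat \<Rightarrow> bool) \<Rightarrow> (nat \<Rightarrow> nat \<Rightarrow> bool)
    \<Rightarrow> ((nat \<times> nat) \<times> (nat \<times> nat)) set" where
  "orient k l r d =
     {((i, j), (i, Suc j)) | i j. (i, j) \<in> h_edges k l \<and> r i j} \<union>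
     {((i, Suc j), (i, j)) | i j. (i, j) \<in> h_edges k l \<and> \<not> r i j} \<union>
     {((i, j), (Suc i, j)) | i j. (i, j) \<in> v_edges k l \<and> d i j} \<union>
     {((Suc i, j), (i, j)) | i j. (i, j) \<in> v_edges k l \<and> \<not> d i j}"

lemma mem_orient:
  "((a, b), (a', b')) \<in> orient k l r d \<longleftrightarrow>
     a' = a \<and> b' = Suc b \<and> (a, b) \<in> h_edges k l \<and> r a b \<or>
     a' = a \<and> b = Suc b' \<and> (a, b') \<in> h_edges k l \<and> \<not> r a b' \<or>
     a' = Suc a \<and> b' = b \<and> (a, b) \<in> v_edges k l \<and> d a b \<or>
     a = Suc a' \<and> b' = b \<and> (a', b) \<in> v_edges k l \<and> \<not> d a' b"
  unfolding orient_def by auto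

lemma edges_grid:
  "edges (grid k l) = (\<lambda>(i, j). {(i, j), (i, Suc j)}) ` h_edges k l \<union>
                      (\<lambda>(i, j). {(i, j), (Suc i, j)}) ` v_edges k l"
proof -
  have "{f i j |i j. P i j} = (\<lambda>(i, j). f i j) ` {(i, j). P i j}"
    for f :: "nat \<Rightarrow> nat \<Rightarrow> (nat \<times> nat) set" and P
    by auto
  then show ?thesis
    unfolding grid_def h_edges_def v_edges_def by (simp add: Suc_le_eq)
qed

lemma orient_antisym: "(u, v) \<in> orient k l r d \<Longrightarrow> (v, u) \<notin> orient k l r d"
  by (cases u; cases v) (auto simp: mem_orient)

lemma orient_is_orientation: "is_orientation (grid k l) (orient k l r d)"
  unfolding is_orientation_def bij_betw_def
proof
  show "inj_on (\<lambda>(u, v). {u, v}) (orient k l r d)"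
    using orient_antisym by (fastforce simp: inj_on_def doubleton_eq_iff)
  show "(\<lambda>(u, v). {u, v}) ` orient k l r d = edges (grid k l)" (is "?f ` _ = _")
  proof
    show "?f ` orient k l r d \<subseteq> edges (grid k l)"
    proof
      fix e assume "e \<in> ?f ` orient k l r d"
      then obtain a b a' b' where "((a, b), (a', b')) \<in> orient k l r d" "e = {(a, b), (a', b')}"
        by auto
      then show "e \<in> edges (grid k l)"
        unfolding mem_orient edges_grid image_iff by (elim disjE) (force simp: insert_commute)+
    qed
    show "edges (grid k l) \<subseteq> ?f ` orient k l r d"
    proof
      fix e assume "e \<in> edges (grid k l)"
      then consider i j where "(i, j) \<in> h_edges k l" "e = {(i, j), (i, Suc j)}"
        | i j where "(i, j) \<in> v_edges k l" "e = {(i, j), (Suc i, j)}"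
        unfolding edges_grid by auto
      then show "e \<in> ?f ` orient k l r d"
      proof cases
        case 1
        have "((i, j), (i, Suc j)) \<in> orient k l r d \<or> ((i, Suc j), (i, j)) \<in> orient k l r d"
          using 1 by (auto simp: mem_orient)
        then show ?thesis using 1 by (force simp: insert_commute)
      next
        case 2
        have "((i, j), (Suc i, j)) \<in> orient k l r d \<or> ((Suc i, j), (i, j)) \<in> orient k l r d"
          using 2 by (auto simp: mem_orient)
        then show ?thesis using 2 by (force simp: insert_commute)
      qed
    qed
  qed
qed

text \<open>Both sides contain one arc for each edge of the grid, so an inclusion suffices.\<close>

lemma orientation_eq_orient:
  assumes "is_orientation (grid k l) D"
  shows "D = orient k l (\<lambda>i j. ((i, j), (i, Suc j)) \<in> D) (\<lambda>i j. ((i, j), (Suc i, j)) \<in> D)"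
    (is "D = ?O")
proof -
  have inj: "inj_on (\<lambda>(u, v). {u, v}) D" and im: "(\<lambda>(u, v). {u, v}) ` D = edges (grid k l)"
    using assms unfolding is_orientation_def bij_betw_def by auto
  have arc: "(u, v) \<in> D \<or> (v, u) \<in> D" if "{u, v} \<in> edges (grid k l)" for u v
    using that unfolding im[symmetric] by (auto simp: doubleton_eq_iff)
  have sub: "?O \<subseteq> D"
  proof
    fix a assume "a \<in> ?O"
    then show "a \<in> D"
      unfolding orient_def
    proof (elim UnE; clarsimp)
      fix i j assume "(i, j) \<in> h_edges k l" "((i, j), (i, Suc j)) \<notin> D"
      then show "((i, Suc j), (i, j)) \<in> D"
        using arc[of "(i, j)" "(i, Suc j)"] by (auto simp: edges_grid)
    next
      fix i j assume "(i, j) \<in> v_edges k l" "((i, j), (Suc i, j)) \<notin> D"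
      then show "((Suc i, j), (i, j)) \<in> D"
        using arc[of "(i, j)" "(Suc i, j)"] by (auto simp: edges_grid)
    qed
  qed
  have "(\<lambda>(u, v). {u, v}) ` ?O = (\<lambda>(u, v). {u, v}) ` D"
    using orient_is_orientation unfolding is_orientation_def bij_betw_def im by blast
  then have "?O = D"
    using inj_on_image_eq_iff[OF inj sub subset_refl] by blast
  then show ?thesis by (rule sym)
qed

section \<open>Local structure of bipolar orientations\<close>

text \<open>The vertex \<open>(i, j)\<close> is entered, respectively left, by an arc; each guard says that the neighbour in question
exists.\<close>

definition in_arc :: "nat \<Rightarrow> nat \<Rightarrow> (nat \<Rightarrow> nat \<Rightarrow> bool) \<Rightarrow> (nat \<Rightarrow> nat \<Rightarrow> bool) \<Rightarrow> nat \<Rightarrow> nat \<Rightarrow> bool" where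
  "in_arc k l r d i j \<longleftrightarrow> 1 < j \<and> r i (j - 1) \<or> j < l \<and> \<not> r i j \<or> 1 < i \<and> d (i - 1) j \<or> i < k \<and> \<not> d i j"

definition out_arc :: "nat \<Rightarrow> nat \<Rightarrow> (nat \<Rightarrow> nat \<Rightarrow> bool) \<Rightarrow> (nat \<Rightarrow> nat \<Rightarrow> bool) \<Rightarrow> nat \<Rightarrow> nat \<Rightarrow> bool" where
  "out_arc k l r d i j \<longleftrightarrow> 1 < j \<and> \<not> r i (j - 1) \<or> j < l \<and> r i j \<or> 1 < i \<and> \<not> d (i - 1) j \<or> i < k \<and> d i j"

lemma verts_grid: "(i, j) \<in> verts (grid k l) \<longleftrightarrow> 1 \<le> i \<and> i \<le> k \<and> 1 \<le> j \<and> j \<le> l"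
  by (simp add: grid_def)

lemma in_arc_iff:
  assumes "(i, j) \<in> verts (grid k l)"
  shows "in_arc k l r d i j \<longleftrightarrow> (\<exists>u. (u, (i, j)) \<in> orient k l r d)"
proof
  assume "\<exists>u. (u, (i, j)) \<in> orient k l r d"
  then show "in_arc k l r d i j"
    using assms by (auto simp: mem_orient in_arc_def h_edges_def v_edges_def verts_grid)
next
  assume "in_arc k l r d i j"
  then show "\<exists>u. (u, (i, j)) \<in> orient k l r d"
    unfolding in_arc_def
  proof (elim disjE)
    assume "1 < j \<and> r i (j - 1)"
    then have "((i, j - 1), (i, j)) \<in> orient k l r d"
      using assms by (auto simp: mem_orient h_edges_def verts_grid)
    then show ?thesis ..
  next
    assume "j < l \<and> \<not> r i j"
    then have "((i, Suc j), (i, j)) \<in> orient k l r d"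
      using assms by (auto simp: mem_orient h_edges_def verts_grid)
    then show ?thesis ..
  next
    assume "1 < i \<and> d (i - 1) j"
    then have "((i - 1, j), (i, j)) \<in> orient k l r d"
      using assms by (auto simp: mem_orient v_edges_def verts_grid)
    then show ?thesis ..
  next
    assume "i < k \<and> \<not> d i j"
    then have "((Suc i, j), (i, j)) \<in> orient k l r d"
      using assms by (auto simp: mem_orient v_edges_def verts_grid)
    then show ?thesis ..
  qed
qed

lemma orient_converse: "(u, v) \<in> orient k l r d \<longleftrightarrow> (v, u) \<in> orient k l (\<lambda>i j. \<not> r i j) (\<lambda>i j. \<not> d i j)"
  by (cases u; cases v) (auto simp: mem_orient)

lemma out_arc_iff:
  assumes "(i, j) \<in> verts (grid k l)"
  shows "out_arc k l r d i j \<longleftrightarrow> (\<exists>w. ((i, j), w) \<in> orient k l r d)"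
proof -
  have "out_arc k l r d i j \<longleftrightarrow> in_arc k l (\<lambda>i j. \<not> r i j) (\<lambda>i j. \<not> d i j) i j"
    unfolding out_arc_def in_arc_def by auto
  then show ?thesis
    using in_arc_iff[OF assms] orient_converse by metis
qed

text \<open>An angle is the corner of a unit square at a vertex. It is extremal if both edges bounding it enter the vertex or both leave
it, and lateral otherwise.\<close>

definition angle_sign :: "bool \<Rightarrow> int" where
  "angle_sign extremal = (if extremal then - 1 else 1)"

text \<open>Each unit square is indexed by its upper left vertex. The four identities say that summing over the vertices that have a
square to their lower right, lower left, upper right or upper left is the same as summing over the squares.\<close>

lemma sum_shift_rectangle:
  fixes f :: "nat \<Rightarrow> nat \<Rightarrow> int"
  shows "(\<Sum>(i, j)\<in>{1..k} \<times> {1..l}. if i < k \<and> j < l then f i j else 0) = (\<Sum>(i, j)\<in>{1..<k} \<times> {1..<l}. f i j)"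
    and "(\<Sum>(i, j)\<in>{1..k} \<times> {1..l}. if i < k \<and> 1 < j then f i (j - 1) else 0) = (\<Sum>(i, j)\<in>{1..<k} \<times> {1..<l}. f i j)"
    and "(\<Sum>(i, j)\<in>{1..k} \<times> {1..l}. if 1 < i \<and> j < l then f (i - 1) j else 0) = (\<Sum>(i, j)\<in>{1..<k} \<times> {1..<l}. f i j)"
    and "(\<Sum>(i, j)\<in>{1..k} \<times> {1..l}. if 1 < i \<and> 1 < j then f (i - 1) (j - 1) else 0) = (\<Sum>(i, j)\<in>{1..<k} \<times> {1..<l}. f i j)"
proof -
  have filter: "(\<Sum>(i, j)\<in>A. if P i j then g i j else 0) = (\<Sum>(i, j)\<in>{p \<in> A. P (fst p) (snd p)}. g i j)"
    if "finite A" for A P and g :: "nat \<Rightarrow> nat \<Rightarrow> int"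
    using sum.inter_filter[OF that, of "\<lambda>p. g (fst p) (snd p)" "\<lambda>p. P (fst p) (snd p)"]
    by (simp add: case_prod_beta)
  have fin: "finite ({1..k} \<times> {1..l})" by simp
  show "(\<Sum>(i, j)\<in>{1..k} \<times> {1..l}. if i < k \<and> j < l then f i j else 0) = (\<Sum>(i, j)\<in>{1..<k} \<times> {1..<l}. f i j)"
    unfolding filter[OF fin]
    by (rule sum.reindex_bij_witness[of _ "\<lambda>(i, j). (i, j)" "\<lambda>(i, j). (i, j)"]) auto
  show "(\<Sum>(i, j)\<in>{1..k} \<times> {1..l}. if i < k \<and> 1 < j then f i (j - 1) else 0) = (\<Sum>(i, j)\<in>{1..<k} \<times> {1..<l}. f i j)"
    unfolding filter[OF fin]
    by (rule sum.reindex_bij_witness[of _ "\<lambda>(i, j). (i, j + 1)" "\<lambda>(i, j). (i, j - 1)"]) auto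
  show "(\<Sum>(i, j)\<in>{1..k} \<times> {1..l}. if 1 < i \<and> j < l then f (i - 1) j else 0) = (\<Sum>(i, j)\<in>{1..<k} \<times> {1..<l}. f i j)"
    unfolding filter[OF fin]
    by (rule sum.reindex_bij_witness[of _ "\<lambda>(i, j). (i + 1, j)" "\<lambda>(i, j). (i - 1, j)"]) auto
  show "(\<Sum>(i, j)\<in>{1..k} \<times> {1..l}. if 1 < i \<and> 1 < j then f (i - 1) (j - 1) else 0) = (\<Sum>(i, j)\<in>{1..<k} \<times> {1..<l}. f i j)"
    unfolding filter[OF fin]
    by (rule sum.reindex_bij_witness[of _ "\<lambda>(i, j). (i + 1, j + 1)" "\<lambda>(i, j). (i - 1, j - 1)"]) auto
qed

lemma acyclic_square:
  assumes "acyclic (orient k l r d)" "1 \<le> i" "i < k" "1 \<le> j" "j < l"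
  shows "\<not> (r i j \<and> d i (Suc j) \<and> \<not> r (Suc i) j \<and> \<not> d i j)"
    and "\<not> (\<not> r i j \<and> \<not> d i (Suc j) \<and> r (Suc i) j \<and> d i j)"
proof -
  let ?D = "orient k l r d"
  have no_cycle: False if "(a, b) \<in> ?D" "(b, c) \<in> ?D" "(c, e) \<in> ?D" "(e, a) \<in> ?D" for a b c e
  proof -
    have "(a, a) \<in> ?D\<^sup>+" using that by (meson trancl.simps)
    then show False using assms(1) unfolding acyclic_def by blast
  qed
  show "\<not> (r i j \<and> d i (Suc j) \<and> \<not> r (Suc i) j \<and> \<not> d i j)"
    using assms(2-) no_cycle[of "(i, j)" "(i, Suc j)" "(Suc i, Suc j)" "(Suc i, j)"]
    by (auto simp: mem_orient h_edges_def v_edges_def)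
  show "\<not> (\<not> r i j \<and> \<not> d i (Suc j) \<and> r (Suc i) j \<and> d i j)"
    using assms(2-) no_cycle[of "(i, j)" "(Suc i, j)" "(Suc i, Suc j)" "(i, Suc j)"]
    by (auto simp: mem_orient h_edges_def v_edges_def)
qed

text \<open>All angles are summed with their signs in two ways. A square whose boundary is not a directed cycle has at least two extremal
angles, so every square sums to at most 0. A vertex that is neither source nor sink has arcs of both kinds, so an interior
or side vertex sums to at least 0; the two corners other than source and sink contribute 1 each, which makes up for the at
least - 1 of source and sink. Hence all these bounds are attained. A square or interior vertex with sum 0 has two opposite
edges in parallel.\<close>

lemma bipolar_local_structure:
  assumes kl: "2 \<le> k" "2 \<le> l" and t: "t = (k, l) \<or> t = (k, 1)"
    and bip: "bipolar_orientation (grid k l) (1, 1) t (orient k l r d)"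
  shows "\<lbrakk>1 \<le> i; i < k; 1 \<le> j; j < l\<rbrakk> \<Longrightarrow> r i j = r (i + 1) j \<or> d i j = d i (j + 1)"
    and "\<lbrakk>1 < i; i < k; 1 < j; j < l\<rbrakk> \<Longrightarrow> r i (j - 1) = r i j \<or> d (i - 1) j = d i j"
proof -
  define SE where "SE i j = angle_sign (r i j = d i j)" for i j
  define SW where "SW i j = angle_sign (r i j \<noteq> d i (j + 1))" for i j
  define NE where "NE i j = angle_sign (r (i + 1) j \<noteq> d i j)" for i j
  define NW where "NW i j = angle_sign (r (i + 1) j = d i (j + 1))" for i j
  define face where "face i j = SE i j + SW i j + NE i j + NW i j" for i j
  define vertex where "vertex i j =
      (if i < k \<and> j < l then SE i j else 0) + (if i < k \<and> 1 < j then SW i (j - 1) else 0) +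
      (if 1 < i \<and> j < l then NE (i - 1) j else 0) + (if 1 < i \<and> 1 < j then NW (i - 1) (j - 1) else 0)" for i j
  \<comment> \<open>The lower bound for the vertex sums; it adds up to 0 over the four corners.\<close>
  define corner where "corner i j = (if (i, j) = (1, 1) \<or> (i, j) = t then - 1
      else if (i = 1 \<or> i = k) \<and> (j = 1 \<or> j = l) then 1 else 0 :: int)" for i j
  let ?V = "{1..k} \<times> {1..l}" and ?F = "{1..<k} \<times> {1..<l}"
  have ac: "acyclic (orient k l r d)"
    and src: "sources (grid k l) (orient k l r d) = {(1, 1)}"
    and snk: "sinks (grid k l) (orient k l r d) = {t}"
    using bip unfolding bipolar_orientation_def by auto
  have split_plus: "(\<Sum>(i, j)\<in>A. f i j + g i j) = (\<Sum>(i, j)\<in>A. f i j) + (\<Sum>(i, j)\<in>A. g i j)"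
    for A and f g :: "nat \<Rightarrow> nat \<Rightarrow> int"
    by (simp add: case_prod_beta sum.distrib)
  have double_count: "(\<Sum>(i, j)\<in>?V. vertex i j) = (\<Sum>(i, j)\<in>?F. face i j)"
    unfolding vertex_def face_def
    by (simp only: split_plus sum_shift_rectangle)
  have face_le: "face i j \<le> 0" if "(i, j) \<in> ?F" for i j
    using acyclic_square[OF ac, of i j] that
    by (auto simp: face_def SE_def SW_def NE_def NW_def angle_sign_def)
  have vertex_ge: "corner i j \<le> vertex i j" if v: "(i, j) \<in> ?V" for i j
  proof -
    have vg: "(i, j) \<in> verts (grid k l)" using v by (auto simp: verts_grid)
    have "in_arc k l r d i j \<or> (i, j) = (1, 1)"
      using in_arc_iff[OF vg] src vg unfolding sources_def by blast
    moreover have "out_arc k l r d i j \<or> (i, j) = t"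
      using out_arc_iff[OF vg] snk vg unfolding sinks_def by blast
    moreover have "i = 1 \<or> i = k \<or> 1 < i \<and> i < k" "j = 1 \<or> j = l \<or> 1 < j \<and> j < l"
      using v by auto
    ultimately show ?thesis
      using kl t
      by (elim disjE; simp add: corner_def vertex_def in_arc_def out_arc_def)
         (auto simp: SE_def SW_def NE_def NW_def angle_sign_def)
  qed
  have corners: "(\<Sum>(i, j)\<in>?V. corner i j) = 0"
  proof -
    have "(\<Sum>(i, j)\<in>?V. corner i j) = (\<Sum>(i, j)\<in>{(1, 1), (1, l), (k, 1), (k, l)}. corner i j)"
      by (rule sum.mono_neutral_right) (use kl t in \<open>auto simp: corner_def split: if_splits\<close>)
    also have "\<dots> = 0" using kl t by (auto simp: corner_def)
    finally show ?thesis .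
  qed
  have "(\<Sum>(i, j)\<in>?V. vertex i j - corner i j) = (\<Sum>(i, j)\<in>?F. face i j)"
    using corners double_count by (simp add: case_prod_beta sum_subtractf)
  moreover have "(\<Sum>(i, j)\<in>?F. face i j) \<le> 0"
    by (rule sum_nonpos) (use face_le in auto)
  moreover have "0 \<le> (\<Sum>(i, j)\<in>?V. vertex i j - corner i j)"
    by (rule sum_nonneg) (use vertex_ge in auto)
  ultimately have zero: "(\<Sum>(i, j)\<in>?V. vertex i j - corner i j) = 0" "(\<Sum>(i, j)\<in>?F. - face i j) = 0"
    by (simp_all add: case_prod_beta sum_negf)
  have vertex0: "\<forall>p\<in>?V. (case p of (i, j) \<Rightarrow> vertex i j - corner i j) = 0"
    by (subst sum_nonneg_eq_0_iff[symmetric]) (use zero vertex_ge in auto)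
  have face0: "\<forall>p\<in>?F. (case p of (i, j) \<Rightarrow> - face i j) = 0"
    by (subst sum_nonneg_eq_0_iff[symmetric]) (use zero face_le in auto)
  show "r i j = r (i + 1) j \<or> d i j = d i (j + 1)" if "1 \<le> i" "i < k" "1 \<le> j" "j < l"
  proof -
    have "face i j = 0" using bspec[OF face0, of "(i, j)"] that by simp
    then show ?thesis
      by (auto simp: face_def SE_def SW_def NE_def NW_def angle_sign_def split: if_splits)
  qed
  show "r i (j - 1) = r i j \<or> d (i - 1) j = d i j" if "1 < i" "i < k" "1 < j" "j < l"
  proof -
    have "vertex i j = 0"
      using bspec[OF vertex0, of "(i, j)"] that t by (auto simp: corner_def)
    then show ?thesis
      using that
      by (auto simp: vertex_def SE_def SW_def NE_def NW_def angle_sign_def split: if_splits)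
  qed
qed

section \<open>Counting ice configurations along antidiagonals\<close>

text \<open>The possible contents of one antidiagonal of the midpoint lattice: \<open>B\<close> is the set of ordinates whose bit is set, and \<open>p\<close>,
\<open>q\<close> are the bits read off the preceding antidiagonals. A bit whose predecessor differs from \<open>q y\<close> is forced to
be \<open>p y\<close>; otherwise it is free.\<close>

definition chains :: "(nat \<Rightarrow> bool) \<Rightarrow> (nat \<Rightarrow> bool) \<Rightarrow> nat \<Rightarrow> nat \<Rightarrow> nat set set" where
  "chains p q c n = {B. B \<subseteq> {c..c + n} \<and>
     (\<forall>y\<in>{c<..c + n}. ((y \<in> B) = p y) \<or> ((y - 1 \<in> B) = q y))}"

text \<open>A free bit takes both values, but at most one of them leaves the next bit free, so the counts grow like
Fibonacci numbers whatever \<open>p\<close> and \<open>q\<close> are. The induction carries along the chains with a prescribed last bit: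
there are at most as many of these as chains with one bit less, so their bound is smaller by a factor \<open>x\<close>, and only chains
whose last bit is \<open>q y\<close> can be continued in two ways.\<close>

lemma card_chains_le:
  fixes x :: real
  assumes x: "1 \<le> x" "x \<le> 2" "x + 1 \<le> x\<^sup>2"
  shows "real (card (chains p q c n)) \<le> 2 * x ^ n"
proof -
  let ?T = "chains p q c"
  have fin: "finite (?T n)" for n
    by (rule finite_subset[of _ "Pow {c..c+n}"]) (auto simp: chains_def)
  have "real (card (?T n)) \<le> 2 * x ^ n \<and>
     (\<forall>v. x * real (card {B \<in> ?T n. (c + n \<in> B) = v}) \<le> 2 * x ^ n)" for n
  proof (induction n)
    case 0
    have T0: "?T 0 = {{}, {c}}" unfolding chains_def by auto
    have "{B \<in> {{}, {c}}. (c \<in> B) = v} = {if v then {c} else {}}" for v by auto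
    then show ?case using x by (auto simp: T0)
  next
    case (Suc n)
    let ?last = "c + Suc n"
    let ?L = "\<lambda>v. {B \<in> ?T (Suc n). (?last \<in> B) = v}"
    let ?f = "\<lambda>B. B \<inter> {c..c + n}"
    have restr: "?f B \<in> ?T n" if "B \<in> ?T (Suc n)" for B
      using that unfolding chains_def by (auto simp: Ball_def)
    have inj: "inj_on ?f (?L v)" for v
    proof (rule inj_onI)
      fix B C assume BC: "B \<in> ?L v" "C \<in> ?L v" "?f B = ?f C"
      have "B = ?f B \<union> (if v then {?last} else {})" "C = ?f C \<union> (if v then {?last} else {})"
        using BC(1,2) unfolding chains_def by (auto simp: le_Suc_eq)
      with BC(3) show "B = C" by simp
    qed
    have card_L: "card (?L v) \<le> card (?T n)" for v
      by (rule card_inj_on_le[OF inj _ fin]) (use restr in auto)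
    have "?f ` ?L (\<not> p ?last) \<subseteq> {B \<in> ?T n. (c + n \<in> B) = q ?last}"
    proof (rule image_subsetI)
      fix B assume B: "B \<in> ?L (\<not> p ?last)"
      then have "(?last - 1 \<in> B) = q ?last" unfolding chains_def by auto
      with B restr show "?f B \<in> {B \<in> ?T n. (c + n \<in> B) = q ?last}" by auto
    qed
    then have card_Lp: "card (?L (\<not> p ?last)) \<le> card {B \<in> ?T n. (c + n \<in> B) = q ?last}"
      by (rule card_inj_on_le[OF inj]) (use fin in auto)
    have split: "?T (Suc n) = ?L (p ?last) \<union> ?L (\<not> p ?last)" by auto
    have "card (?T (Suc n)) \<le> card (?L (p ?last)) + card (?L (\<not> p ?last))"
      using card_Un_le[of "?L (p ?last)" "?L (\<not> p ?last)"] unfolding split[symmetric] .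
    also have "\<dots> \<le> card (?T n) + card {B \<in> ?T n. (c + n \<in> B) = q ?last}"
      using card_L card_Lp by (rule add_mono)
    finally have tot: "real (card (?T (Suc n))) \<le>
        real (card (?T n)) + real (card {B \<in> ?T n. (c + n \<in> B) = q ?last})"
      by linarith
    have "x * real (card (?T (Suc n))) \<le> x * real (card (?T n)) +
        x * real (card {B \<in> ?T n. (c + n \<in> B) = q ?last})"
      using mult_left_mono[OF tot, of x] x by (simp add: distrib_left)
    also have "\<dots> \<le> x * (2 * x ^ n) + 2 * x ^ n"
      using Suc x by (intro add_mono mult_left_mono) auto
    also have "\<dots> = (x + 1) * (2 * x ^ n)" by (simp add: algebra_simps)
    also have "\<dots> \<le> x\<^sup>2 * (2 * x ^ n)" using x by (intro mult_right_mono) auto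
    also have "\<dots> = x * (2 * x ^ Suc n)" by (simp add: power2_eq_square)
    finally have "real (card (?T (Suc n))) \<le> 2 * x ^ Suc n" using x by simp
    moreover have "x * real (card (?L v)) \<le> 2 * x ^ Suc n" for v
    proof -
      have "real (card (?L v)) \<le> 2 * x ^ n" using card_L[of v] Suc by linarith
      then show ?thesis using mult_left_mono[of _ "2 * x ^ n" x] x by simp
    qed
    ultimately show ?case by blast
  qed
  then show ?thesis by blast
qed

text \<open>The midpoints of the grid edges in doubled coordinates, shifted so that the vertex \<open>(1, 1)\<close> becomes the
origin: horizontal edges have an even first coordinate, vertical edges an odd one. The points with even coordinate sum
are the vertices (both even) and the unit squares (both odd).\<close>

definition medial :: "nat \<Rightarrow> nat \<Rightarrow> (nat \<times> nat) set" where
  "medial m n = {(X, Y). X \<le> m \<and> Y \<le> n \<and> odd (X + Y)}"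

text \<open>Vertices and squares obey the same rule here: around each interior even point, two opposite bits agree. These are the
configurations of the six-vertex (ice) model on the lattice of even points; a set collects the edges whose bit is set.\<close>

definition ice :: "nat \<Rightarrow> nat \<Rightarrow> (nat \<times> nat) set set" where
  "ice m n = {E. E \<subseteq> medial m n \<and>
     (\<forall>X Y. 0 < X \<and> X < m \<and> 0 < Y \<and> Y < n \<and> even (X + Y) \<longrightarrow>
        ((X, Y - 1) \<in> E \<longleftrightarrow> (X, Y + 1) \<in> E) \<or> ((X - 1, Y) \<in> E \<longleftrightarrow> (X + 1, Y) \<in> E))}"

lemma finite_medial: "finite (medial m n)"
  by (rule finite_subset[of _ "{0..m} \<times> {0..n}"]) (auto simp: medial_def)

lemma finite_ice: "finite (ice m n)"
  by (rule finite_subset[of _ "Pow (medial m n)"]) (auto simp: ice_def finite_medial)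

lemma card_image_le_fibres:
  fixes b :: real
  assumes fin: "finite C"
    and fibre: "\<And>F. F \<in> f ` C \<Longrightarrow> real (card (g ` {E \<in> C. f E = F})) \<le> b"
  shows "real (card (g ` C)) \<le> real (card (f ` C)) * b"
proof -
  have "g ` C = (\<Union>F\<in>f ` C. g ` {E \<in> C. f E = F})" by auto
  then have "card (g ` C) \<le> (\<Sum>F\<in>f ` C. card (g ` {E \<in> C. f E = F}))"
    using card_UN_le[of "f ` C" "\<lambda>F. g ` {E \<in> C. f E = F}"] fin by simp
  then have "real (card (g ` C)) \<le> (\<Sum>F\<in>f ` C. real (card (g ` {E \<in> C. f E = F})))"
    by (simp flip: of_nat_sum)
  also have "\<dots> \<le> (\<Sum>F\<in>f ` C. b)" by (rule sum_mono) (rule fibre)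
  finally show ?thesis by simp
qed

text \<open>The configuration is revealed one antidiagonal \<open>X + Y = 2 d + 1\<close> at a time, after the bits on the two
sides \<open>X = 0\<close> and \<open>Y = 0\<close>. With the earlier antidiagonals known, the rules at the even points just below the new
antidiagonal say that its bits form a chain, so it contributes a factor \<open>2 x\<^sup>L\<close> where \<open>L\<close> is its length. The
lengths add up to at most the number of all points, and the constants are exponential in the perimeter only.\<close>

lemma ice_count:
  fixes x :: real
  assumes x: "1 \<le> x" "x \<le> 2" "x + 1 \<le> x\<^sup>2"
  shows "real (card (ice m n)) \<le> 2 ^ (2 * (m + n + 1)) * x ^ card (medial m n)"
proof -
  \<comment> \<open>The region revealed before antidiagonal \<open>2 * d + 1\<close>.\<close>
  define P where "P d = {(X, Y) \<in> medial m n. X = 0 \<or> Y = 0 \<or> X + Y < 2 * d + 1}" for d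
  have finP: "finite (P d)" for d
    by (rule finite_subset[OF _ finite_medial]) (auto simp: P_def)
  have step: "real (card ((\<lambda>E. E \<inter> P (Suc d)) ` {E \<in> ice m n. E \<inter> P d = F}))
      \<le> 2 * x ^ card (P (Suc d) - P d)" (is "real (card ?G) \<le> _") for d F
  proof -
    define s where "s = 2 * d + 1"
    define c where "c = max 1 (s - m)"
    define e where "e = min n (s - 1)"
    have Q: "P (Suc d) - P d = (\<lambda>Y. (s - Y, Y)) ` {c..e}"
    proof
      show "P (Suc d) - P d \<subseteq> (\<lambda>Y. (s - Y, Y)) ` {c..e}"
      proof clarify
        fix X Y assume a: "(X, Y) \<in> P (Suc d)" "(X, Y) \<notin> P d"
        then have "0 < X" "0 < Y" "X + Y \<ge> s" "X + Y < s + 2" "odd (X + Y)" "X \<le> m" "Y \<le> n"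
          by (auto simp: P_def s_def medial_def)
        moreover from this have "X + Y = s" unfolding s_def by presburger
        ultimately show "(X, Y) \<in> (\<lambda>Y. (s - Y, Y)) ` {c..e}"
          unfolding c_def e_def by (intro image_eqI[of _ _ Y]) auto
      qed
      show "(\<lambda>Y. (s - Y, Y)) ` {c..e} \<subseteq> P (Suc d) - P d"
        unfolding P_def s_def medial_def c_def e_def by auto
    qed
    have cardQ: "card (P (Suc d) - P d) = card {c..e}"
      unfolding Q by (rule card_image) (auto simp: inj_on_def)
    have decomp: "E \<inter> P (Suc d) = F \<union> E \<inter> (P (Suc d) - P d)" if "E \<inter> P d = F" for E
      using that unfolding P_def by auto
    show ?thesis
    proof (cases "c \<le> e")
      case False
      then have "P (Suc d) - P d = {}" unfolding Q by simp
      then have "?G \<subseteq> {F}" using decomp by auto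
      then have "card ?G \<le> 1" using card_mono[of "{F}" ?G] by simp
      moreover have "1 \<le> 2 * x ^ card (P (Suc d) - P d)"
        using one_le_power[OF x(1), of "card (P (Suc d) - P d)"] by linarith
      ultimately show ?thesis by linarith
    next
      case True
      then obtain N where N: "e = c + N" using le_Suc_ex by blast
      \<comment> \<open>The even point responsible for the bit at \<open>(s - y, y)\<close> is \<open>(s - y, y - 1)\<close>.\<close>
      define p where "p y = ((s - y, y - 2) \<in> F)" for y
      define q where "q y = ((s - y - 1, y - 1) \<in> F)" for y
      define h where "h A = {y \<in> {c..e}. (s - y, y) \<in> A}" for A :: "(nat \<times> nat) set"
      let ?T = "chains p q c N"
      have "h ` ?G \<subseteq> ?T"
      proof clarify
        fix E assume E: "E \<in> ice m n" "F = E \<inter> P d"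
        have "(y \<in> h (E \<inter> P (Suc d))) = p y \<or> (y - 1 \<in> h (E \<inter> P (Suc d))) = q y"
          if y: "y \<in> {c<..c + N}" for y
        proof -
          define X where "X = s - y"
          have cy: "c < y" "y \<le> e" using y N by auto
          then have yb: "2 \<le> y" "y \<le> n" "1 \<le> X" "X < m" "X + y = s"
            using cy unfolding c_def e_def X_def by auto
          have odd: "odd s" unfolding s_def by simp
          with yb have par: "even X \<longleftrightarrow> odd y" by (metis even_add)
          have "((X, y - 1 - 1) \<in> E \<longleftrightarrow> (X, y - 1 + 1) \<in> E) \<or> ((X - 1, y - 1) \<in> E \<longleftrightarrow> (X + 1, y - 1) \<in> E)"
            using E(1) yb odd unfolding ice_def mem_Collect_eq
            by (elim conjE allE[of _ X] allE[of _ "y - 1"] impE) (auto simp: X_def)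
          moreover have "(X, y - 2) \<in> E \<longleftrightarrow> p y" "(X - 1, y - 1) \<in> E \<longleftrightarrow> q y"
            using yb odd unfolding p_def q_def E(2) P_def medial_def s_def[symmetric] X_def[symmetric]
            by auto
          moreover have "(X, y) \<in> P (Suc d)" "(X + 1, y - 1) \<in> P (Suc d)"
            using yb par unfolding P_def medial_def s_def by auto
          moreover have "s - y = X" "s - (y - 1) = X + 1" "y - 1 \<in> {c..e}" "y \<in> {c..e}" "y - 1 - 1 = y - 2" "y - 1 + 1 = y"
            using yb cy unfolding X_def by auto
          ultimately show ?thesis unfolding h_def by auto
        qed
        then show "h (E \<inter> P (Suc d)) \<in> ?T"
          unfolding chains_def N[symmetric] by (auto simp: h_def)
      qed
      moreover have "inj_on h ?G"
      proof (rule inj_onI)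
        fix A A' assume A: "A \<in> ?G" "A' \<in> ?G" "h A = h A'"
        have rebuild: "A = F \<union> (\<lambda>y. (s - y, y)) ` h A" if "A \<in> ?G" for A
        proof -
          from that obtain E where "E \<inter> P d = F" "A = E \<inter> P (Suc d)" by auto
          then have "A = F \<union> E \<inter> (\<lambda>Y. (s - Y, Y)) ` {c..e}" "(\<lambda>Y. (s - Y, Y)) ` {c..e} \<subseteq> P (Suc d)"
            using decomp[of E] Q by auto
          then show ?thesis using \<open>A = E \<inter> P (Suc d)\<close> unfolding h_def by auto
        qed
        have "A = F \<union> (\<lambda>y. (s - y, y)) ` h A'"
          using rebuild[OF A(1)] unfolding A(3) .
        then show "A = A'" using rebuild[OF A(2)] by (rule trans[OF _ sym])
      qed
      moreover have "finite ?T" by (rule finite_subset[of _ "Pow {c..c+N}"]) (auto simp: chains_def)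
      ultimately have "card ?G \<le> card ?T" by (intro card_inj_on_le)
      also have "real (card ?T) \<le> 2 * x ^ N" by (rule card_chains_le[OF x])
      also have "\<dots> \<le> 2 * x ^ card (P (Suc d) - P d)"
        unfolding cardQ N by (intro mult_left_mono power_increasing) (use x in auto)
      finally show ?thesis by simp
    qed
  qed
  have bound: "real (card ((\<lambda>E. E \<inter> P d) ` ice m n)) \<le> 2 ^ (m + n + 2 + d) * x ^ card (P d)" for d
  proof (induction d)
    case 0
    have "P 0 \<subseteq> {0} \<times> {0..n} \<union> {0..m} \<times> {0}" by (auto simp: P_def medial_def)
    then have "card (P 0) \<le> card ({0} \<times> {0..n} \<union> {0..m} \<times> {0 :: nat})" by (intro card_mono) auto
    also have "\<dots> \<le> m + n + 2"
      using card_Un_le[of "{0 :: nat} \<times> {0..n}" "{0..m} \<times> {0 :: nat}"] by (simp add: card_cartesian_product)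
    finally have "card (P 0) \<le> m + n + 2" .
    have "card ((\<lambda>E. E \<inter> P 0) ` ice m n) \<le> card (Pow (P 0))"
      by (intro card_mono) (auto simp: finP)
    also have "\<dots> \<le> 2 ^ (m + n + 2)"
      unfolding card_Pow[OF finP] using \<open>card (P 0) \<le> m + n + 2\<close>
      by (rule power_increasing) simp
    finally have "real (card ((\<lambda>E. E \<inter> P 0) ` ice m n)) \<le> 2 ^ (m + n + 2)"
      using of_nat_mono by fastforce
    also have "\<dots> \<le> 2 ^ (m + n + 2 + 0) * x ^ card (P 0)"
      using one_le_power[OF x(1), of "card (P 0)"] by simp
    finally show ?case .
  next
    case (Suc d)
    have "P d \<subseteq> P (Suc d)" by (auto simp: P_def)
    then have card_P: "card (P (Suc d)) = card (P d) + card (P (Suc d) - P d)"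
      using finP by (metis card_Diff_subset card_mono le_add_diff_inverse)
    have "real (card ((\<lambda>E. E \<inter> P (Suc d)) ` ice m n)) \<le>
        real (card ((\<lambda>E. E \<inter> P d) ` ice m n)) * (2 * x ^ card (P (Suc d) - P d))"
      by (rule card_image_le_fibres[OF finite_ice step])
    also have "\<dots> \<le> (2 ^ (m + n + 2 + d) * x ^ card (P d)) * (2 * x ^ card (P (Suc d) - P d))"
      using Suc x by (intro mult_right_mono) auto
    also have "\<dots> = 2 ^ (m + n + 2 + Suc d) * x ^ card (P (Suc d))"
      unfolding card_P power_add by simp
    finally show ?case .
  qed
  have all: "P (m + n) = medial m n" by (auto simp: P_def medial_def)
  have id: "(\<lambda>E. E \<inter> medial m n) ` ice m n = ice m n"
    unfolding ice_def by (auto simp: image_iff)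
  have "m + n + 2 + (m + n) = 2 * (m + n + 1)" by simp
  with bound[of "m + n"] show ?thesis unfolding all id by (simp only:)
qed

section \<open>The upper bound\<close>

lemma orient_cong:
  assumes "\<And>i j. (i, j) \<in> h_edges k l \<Longrightarrow> r i j = r' i j"
    and "\<And>i j. (i, j) \<in> v_edges k l \<Longrightarrow> d i j = d' i j"
  shows "orient k l r d = orient k l r' d'"
proof (rule set_eqI)
  fix a :: "(nat \<times> nat) \<times> (nat \<times> nat)"
  obtain i j i' j' where "a = ((i, j), (i', j'))" by (metis surj_pair)
  then show "a \<in> orient k l r d \<longleftrightarrow> a \<in> orient k l r' d'"
    by (simp add: mem_orient assms cong: conj_cong)
qed

text \<open>Halving the doubled coordinates sends both kinds of midpoints to the left or upper end of their edge.\<close>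

definition medial_code :: "nat \<Rightarrow> nat \<Rightarrow> (nat \<Rightarrow> nat \<Rightarrow> bool) \<Rightarrow> (nat \<Rightarrow> nat \<Rightarrow> bool) \<Rightarrow> (nat \<times> nat) set" where
  "medial_code k l r d = {(X, Y) \<in> medial (2 * k - 2) (2 * l - 2).
     if even X then r (X div 2 + 1) (Y div 2 + 1) else d (X div 2 + 1) (Y div 2 + 1)}"

lemma mem_medial_code:
  "(i, j) \<in> h_edges k l \<Longrightarrow> (2 * i - 2, 2 * j - 1) \<in> medial_code k l r d \<longleftrightarrow> r i j"
  "(i, j) \<in> v_edges k l \<Longrightarrow> (2 * i - 1, 2 * j - 2) \<in> medial_code k l r d \<longleftrightarrow> d i j"
proof -
  assume "(i, j) \<in> h_edges k l"
  then obtain a b where "i = Suc a" "j = Suc b" "a < k" "Suc b < l"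
    by (cases i; cases j) (auto simp: h_edges_def)
  then show "(2 * i - 2, 2 * j - 1) \<in> medial_code k l r d \<longleftrightarrow> r i j"
    by (auto simp: medial_code_def medial_def)
next
  assume "(i, j) \<in> v_edges k l"
  then obtain a b where "i = Suc a" "j = Suc b" "Suc a < k" "b < l"
    by (cases i; cases j) (auto simp: v_edges_def)
  then show "(2 * i - 1, 2 * j - 2) \<in> medial_code k l r d \<longleftrightarrow> d i j"
    by (auto simp: medial_code_def medial_def)
qed

lemma medial_code_ice:
  assumes face: "\<And>i j. \<lbrakk>1 \<le> i; i < k; 1 \<le> j; j < l\<rbrakk> \<Longrightarrow> r i j = r (i + 1) j \<or> d i j = d i (j + 1)"
    and vertex: "\<And>i j. \<lbrakk>1 < i; i < k; 1 < j; j < l\<rbrakk> \<Longrightarrow> r i (j - 1) = r i j \<or> d (i - 1) j = d i j"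
  shows "medial_code k l r d \<in> ice (2 * k - 2) (2 * l - 2)"
proof -
  let ?E = "medial_code k l r d"
  have "((X, Y - 1) \<in> ?E \<longleftrightarrow> (X, Y + 1) \<in> ?E) \<or> ((X - 1, Y) \<in> ?E \<longleftrightarrow> (X + 1, Y) \<in> ?E)"
    if XY: "0 < X" "X < 2 * k - 2" "0 < Y" "Y < 2 * l - 2" "even (X + Y)" for X Y
  proof (cases "even X")
    case True
    then have "even Y" using XY by simp
    obtain a b where ab: "X = 2 * Suc a" "Y = 2 * Suc b"
    proof
      show "X = 2 * Suc (X div 2 - 1)" using \<open>even X\<close> XY by presburger
      show "Y = 2 * Suc (Y div 2 - 1)" using \<open>even Y\<close> XY by presburger
    qed
    have bounds: "Suc (Suc a) < k" "Suc (Suc b) < l" using ab XY by auto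
    then obtain K L where "k = Suc (Suc (Suc a) + K)" "l = Suc (Suc (Suc b) + L)"
      using less_imp_Suc_add by blast
    with bounds show ?thesis
      using vertex[of "Suc (Suc a)" "Suc (Suc b)"] unfolding ab
      by (simp add: medial_code_def medial_def)
  next
    case False
    then have "odd Y" using XY by simp
    with False obtain a b where ab: "X = 2 * a + 1" "Y = 2 * b + 1"
      by (elim oddE)
    have bounds: "Suc a < k" "Suc b < l" using ab XY by auto
    then obtain K L where "k = Suc (Suc a + K)" "l = Suc (Suc b + L)"
      using less_imp_Suc_add by blast
    with bounds show ?thesis
      using face[of "Suc a" "Suc b"] unfolding ab
      by (auto simp: medial_code_def medial_def)
  qed
  then show ?thesis unfolding ice_def by (auto simp: medial_code_def)
qed

lemma card_grid_le_ice:
  assumes "2 \<le> k" "2 \<le> l"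
  shows "card (grid_bipolar_orientations k l) \<le> card (ice (2 * k - 2) (2 * l - 2))"
proof (rule card_inj_on_le)
  let ?r = "\<lambda>D i j. ((i, j), (i, Suc j)) \<in> D" and ?d = "\<lambda>D i j. ((i, j), (Suc i, j)) \<in> D"
  let ?code = "\<lambda>D. medial_code k l (?r D) (?d D)"
  have eq: "D = orient k l (?r D) (?d D)" if "D \<in> grid_bipolar_orientations k l" for D
    using that orientation_eq_orient
    unfolding grid_bipolar_orientations_def bipolar_orientation_def by blast
  show "inj_on ?code (grid_bipolar_orientations k l)"
  proof (rule inj_onI)
    fix D D' assume D: "D \<in> grid_bipolar_orientations k l" "D' \<in> grid_bipolar_orientations k l"
      and code: "?code D = ?code D'"
    have "orient k l (?r D) (?d D) = orient k l (?r D') (?d D')"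
    proof (rule orient_cong)
      fix i j assume e: "(i, j) \<in> h_edges k l"
      show "?r D i j = ?r D' i j"
        using mem_medial_code(1)[OF e, of "?r D" "?d D"] mem_medial_code(1)[OF e, of "?r D'" "?d D'"]
        unfolding code by blast
    next
      fix i j assume e: "(i, j) \<in> v_edges k l"
      show "?d D i j = ?d D' i j"
        using mem_medial_code(2)[OF e, of "?r D" "?d D"] mem_medial_code(2)[OF e, of "?r D'" "?d D'"]
        unfolding code by blast
    qed
    then show "D = D'" using eq[OF D(1)] eq[OF D(2)] by (rule box_equals[OF _ sym sym])
  qed
  show "?code ` grid_bipolar_orientations k l \<subseteq> ice (2 * k - 2) (2 * l - 2)"
  proof (rule image_subsetI)
    fix D assume D: "D \<in> grid_bipolar_orientations k l"
    then have "bipolar_orientation (grid k l) (1, 1) (grid_sink k l) (orient k l (?r D) (?d D))"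
      unfolding eq[OF D, symmetric] grid_bipolar_orientations_def by simp
    moreover have "grid_sink k l = (k, l) \<or> grid_sink k l = (k, 1)" by (simp add: grid_sink_def)
    ultimately show "?code D \<in> ice (2 * k - 2) (2 * l - 2)"
      using bipolar_local_structure[OF assms] by (intro medial_code_ice) blast+
  qed
qed (rule finite_ice)

lemma card_medial_le:
  assumes "1 \<le> k" "1 \<le> l"
  shows "card (medial (2 * k - 2) (2 * l - 2)) \<le> 2 * (k * l)"
proof -
  let ?f = "\<lambda>(X, Y). (X div 2, Y div 2, even X)"
  have "card (medial (2 * k - 2) (2 * l - 2)) \<le> card ({..<k} \<times> {..<l} \<times> (UNIV :: bool set))"
  proof (rule card_inj_on_le)
    show "inj_on ?f (medial (2 * k - 2) (2 * l - 2))"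
    proof (rule inj_onI, clarify)
      fix X Y X' Y' :: nat
      assume "(X, Y) \<in> medial (2 * k - 2) (2 * l - 2)" "(X', Y') \<in> medial (2 * k - 2) (2 * l - 2)"
        and "X div 2 = X' div 2" "Y div 2 = Y' div 2" "even X = even X'"
      moreover from this have "even Y = even Y'" by (auto simp: medial_def)
      ultimately show "X = X' \<and> Y = Y'" by (metis dvd_mult_div_cancel odd_two_times_div_two_succ)
    qed
    show "?f ` medial (2 * k - 2) (2 * l - 2) \<subseteq> {..<k} \<times> {..<l} \<times> UNIV"
      using assms by (auto simp: medial_def)
  qed simp
  also have "\<dots> = 2 * (k * l)" by (simp add: card_cartesian_product)
  finally show ?thesis .
qed

lemma card_grid_upper:
  fixes x :: real
  assumes kl: "2 \<le> k" "2 \<le> l" and x: "1 \<le> x" "x \<le> 2" "x + 1 \<le> x\<^sup>2"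
  shows "real (card (grid_bipolar_orientations k l)) \<le> 16 ^ (k + l) * (x\<^sup>2) ^ (k * l)"
proof -
  let ?m = "2 * k - 2" and ?n = "2 * l - 2"
  have "real (card (grid_bipolar_orientations k l)) \<le> real (card (ice ?m ?n))"
    using card_grid_le_ice[OF kl] by simp
  also have "\<dots> \<le> 2 ^ (2 * (?m + ?n + 1)) * x ^ card (medial ?m ?n)"
    by (rule ice_count[OF x])
  also have "\<dots> \<le> 2 ^ (4 * (k + l)) * x ^ (2 * (k * l))"
  proof (rule mult_mono)
    show "(2 :: real) ^ (2 * (?m + ?n + 1)) \<le> 2 ^ (4 * (k + l))"
      by (rule power_increasing) (use kl in simp_all)
    show "x ^ card (medial ?m ?n) \<le> x ^ (2 * (k * l))"
      using x kl by (intro power_increasing card_medial_le) auto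
  qed (use x in auto)
  also have "\<dots> = 16 ^ (k + l) * (x\<^sup>2) ^ (k * l)"
    unfolding power_mult by simp
  finally show ?thesis .
qed

section \<open>Acyclicity by winding numbers\<close>

text \<open>Here \<open>w i j\<close> is the winding number of a closed walk around the square \<open>(i, j)\<close>, and 0 outside the grid. Crossing
an arc from its right to its left does not decrease it. From every square one can leave the grid by such crossings: go east
as long as the edge to the east points down; when it points up, the horizontal edges above and below are parallel and
allow a step north or south. All horizontal edges crossed by a northward run point right, so the run cannot
turn back and ends at an open passage to the next column or at the top of the grid; southward runs are similar.\<close>

lemma winding_nonpos:
  fixes w :: "nat \<Rightarrow> nat \<Rightarrow> int"
  assumes top: "\<And>j. w 0 j = 0" and bottom: "\<And>j. j \<le> l \<Longrightarrow> w k j = 0" and right: "\<And>i. w i l = 0"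
    and east: "\<And>i j. \<lbrakk>1 \<le> i; i < k; 1 \<le> j; j < l; \<not> up i (j + 1)\<rbrakk> \<Longrightarrow> w i j \<le> w i (j + 1)"
    and parallel: "\<And>i j. \<lbrakk>1 \<le> i; i < k; 1 \<le> j; j < l; up i (j + 1)\<rbrakk> \<Longrightarrow> h i j = h (i + 1) j"
    and north: "\<And>i j. \<lbrakk>1 \<le> i; i \<le> k; 1 \<le> j; j < l; h i j\<rbrakk> \<Longrightarrow> w i j \<le> w (i - 1) j"
    and south: "\<And>i j. \<lbrakk>1 \<le> i; i \<le> k; 1 \<le> j; j < l; \<not> h i j\<rbrakk> \<Longrightarrow> w (i - 1) j \<le> w i j"
    and ij: "i \<le> k" "1 \<le> j" "j \<le> l"
  shows "w i j \<le> 0"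
  using \<open>j \<le> l\<close> \<open>1 \<le> j\<close> \<open>i \<le> k\<close>
proof (induction arbitrary: i rule: inc_induct)
  case base
  then show ?case using right by simp
next
  case (step j)
  have next_col: "w i (j + 1) \<le> 0" if "i \<le> k" for i
    using step.IH[OF _ that] by simp
  have j: "1 \<le> j" "j < l" using step by auto
  \<comment> \<open>A northward run: the lower edge of the current square points right.\<close>
  have upward: "w i j \<le> 0" if "i < k" "h (i + 1) j" for i
    using that
  proof (induction i)
    case 0
    then show ?case using top by simp
  next
    case (Suc i)
    show ?case
    proof (cases "up (Suc i) (j + 1)")
      case True
      then have "h (Suc i) j" using parallel[of "Suc i" j] j Suc.prems by simp
      then show ?thesis using north[of "Suc i" j] j Suc by simp
    next
      case False
      then show ?thesis using east[of "Suc i" j] next_col[of "Suc i"] j Suc.prems by simp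
    qed
  qed
  \<comment> \<open>A southward run: the upper edge of the current square points left.\<close>
  have downward: "w i j \<le> 0" if "1 \<le> i" "i \<le> k" "\<not> h i j" for i
    using \<open>i \<le> k\<close> \<open>1 \<le> i\<close> \<open>\<not> h i j\<close>
  proof (induction rule: inc_induct)
    case base
    then show ?case using bottom j by simp
  next
    case (step i)
    show ?case
    proof (cases "up i (j + 1)")
      case True
      then have "\<not> h (i + 1) j" using parallel[of i j] j step by simp
      then show ?thesis using south[of "Suc i" j] j step by simp
    next
      case False
      then show ?thesis using east[of i j] next_col[of i] j step by simp
    qed
  qed
  consider "i = 0" | "i = k" | "1 \<le> i" "i < k" using step.prems by linarith
  then show ?case
  proof cases
    case 3
    show ?thesis
    proof (cases "up i (j + 1)")
      case True
      then show ?thesis using parallel[of i j] upward[of i] downward[of i] 3 j by auto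
    next
      case False
      then show ?thesis using east[of i j] next_col[of i] j 3 by simp
    qed
  qed (use top bottom j in auto)
qed

text \<open>The net amounts that a walk from \<open>x\<close> to \<open>y\<close> carries to the right (\<open>H\<close>) and down (\<open>V\<close>) through the edges. Since
the walk uses each edge in its direction only, nothing cancels and the flow is not zero.\<close>

definition flow :: "nat \<Rightarrow> nat \<Rightarrow> (nat \<Rightarrow> nat \<Rightarrow> bool) \<Rightarrow> (nat \<Rightarrow> nat \<Rightarrow> bool) \<Rightarrow> nat \<times> nat \<Rightarrow> nat \<times> nat
    \<Rightarrow> (nat \<Rightarrow> nat \<Rightarrow> int) \<Rightarrow> (nat \<Rightarrow> nat \<Rightarrow> int) \<Rightarrow> bool" where
  "flow k l r d x y H V \<longleftrightarrow>
     (\<forall>i j. (i, j) \<notin> h_edges k l \<longrightarrow> H i j = 0) \<and> (\<forall>i j. (i, j) \<notin> v_edges k l \<longrightarrow> V i j = 0) \<and>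
     (\<forall>i j. if r i j then 0 \<le> H i j else H i j \<le> 0) \<and> (\<forall>i j. if d i j then 0 \<le> V i j else V i j \<le> 0) \<and>
     (\<exists>i j. H i j \<noteq> 0 \<or> V i j \<noteq> 0) \<and>
     (\<forall>i j. 1 \<le> i \<longrightarrow> 1 \<le> j \<longrightarrow>
        H i j - H i (j - 1) + V i j - V (i - 1) j = of_bool ((i, j) = x) - of_bool ((i, j) = y))"

lemma flow_arc:
  assumes "(x, y) \<in> orient k l r d"
  shows "\<exists>H V. flow k l r d x y H V"
proof -
  obtain a b a' b' where xy: "x = (a, b)" "y = (a', b')" by (cases x; cases y)
  let ?unit = "\<lambda>i j (c :: int) a b. if a = i \<and> b = j then c else 0"
  let ?zero = "\<lambda>_ _. 0 :: int"
  show ?thesis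
    using assms unfolding xy mem_orient
  proof (elim disjE)
    assume "a' = a \<and> b' = Suc b \<and> (a, b) \<in> h_edges k l \<and> r a b"
    then have "flow k l r d (a, b) (a', b') (?unit a b 1) ?zero"
      unfolding flow_def
      by (intro conjI exI[of _ a] exI[of _ b]) (auto simp: h_edges_def)
    then show "\<exists>H V. flow k l r d (a, b) (a', b') H V" by blast
  next
    assume "a' = a \<and> b = Suc b' \<and> (a, b') \<in> h_edges k l \<and> \<not> r a b'"
    then have "flow k l r d (a, b) (a', b') (?unit a b' (- 1)) ?zero"
      unfolding flow_def
      by (intro conjI exI[of _ a] exI[of _ b']) (auto simp: h_edges_def)
    then show "\<exists>H V. flow k l r d (a, b) (a', b') H V" by blast
  next
    assume "a' = Suc a \<and> b' = b \<and> (a, b) \<in> v_edges k l \<and> d a b"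
    then have "flow k l r d (a, b) (a', b') ?zero (?unit a b 1)"
      unfolding flow_def
      by (intro conjI exI[of _ a] exI[of _ b]) (auto simp: v_edges_def)
    then show "\<exists>H V. flow k l r d (a, b) (a', b') H V" by blast
  next
    assume "a = Suc a' \<and> b' = b \<and> (a', b) \<in> v_edges k l \<and> \<not> d a' b"
    then have "flow k l r d (a, b) (a', b') ?zero (?unit a' b (- 1))"
      unfolding flow_def
      by (intro conjI exI[of _ a'] exI[of _ b]) (auto simp: v_edges_def)
    then show "\<exists>H V. flow k l r d (a, b) (a', b') H V" by blast
  qed
qed

lemma flow_add:
  assumes "flow k l r d x y H V" "flow k l r d y z H' V'"
  shows "flow k l r d x z (\<lambda>i j. H i j + H' i j) (\<lambda>i j. V i j + V' i j)"
proof -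
  obtain i j where nz: "H i j \<noteq> 0 \<or> V i j \<noteq> 0" using assms(1) unfolding flow_def by blast
  have sign: "if r i j then 0 \<le> H i j else H i j \<le> 0" "if r i j then 0 \<le> H' i j else H' i j \<le> 0"
    "if d i j then 0 \<le> V i j else V i j \<le> 0" "if d i j then 0 \<le> V' i j else V' i j \<le> 0" for i j
    using assms unfolding flow_def by blast+
  have "H i j + H' i j \<noteq> 0 \<or> V i j + V' i j \<noteq> 0"
    using nz sign[of i j] by (auto split: if_splits)
  then have nonzero: "\<exists>i j. H i j + H' i j \<noteq> 0 \<or> V i j + V' i j \<noteq> 0" by blast
  have div: "(H i j + H' i j) - (H i (j - 1) + H' i (j - 1)) + (V i j + V' i j) - (V (i - 1) j + V' (i - 1) j)
      = of_bool ((i, j) = x) - of_bool ((i, j) = z)" if "1 \<le> i" "1 \<le> j" for i j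
  proof -
    have "H i j - H i (j - 1) + V i j - V (i - 1) j = of_bool ((i, j) = x) - of_bool ((i, j) = y)"
      "H' i j - H' i (j - 1) + V' i j - V' (i - 1) j = of_bool ((i, j) = y) - of_bool ((i, j) = z)"
      using assms that unfolding flow_def by blast+
    then show ?thesis by linarith
  qed
  have supp: "(i, j) \<notin> h_edges k l \<Longrightarrow> H i j + H' i j = 0" "(i, j) \<notin> v_edges k l \<Longrightarrow> V i j + V' i j = 0" for i j
    using assms unfolding flow_def by auto
  have signs: "if r i j then 0 \<le> H i j + H' i j else H i j + H' i j \<le> 0"
    "if d i j then 0 \<le> V i j + V' i j else V i j + V' i j \<le> 0" for i j
    using sign[of i j] by (auto split: if_splits)
  show ?thesis
    unfolding flow_def using nonzero div supp signs by blast
qed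

lemma flow_path:
  "(x, y) \<in> (orient k l r d)\<^sup>+ \<Longrightarrow> \<exists>H V. flow k l r d x y H V"
proof (induction rule: trancl_induct)
  case (base y)
  then show ?case by (rule flow_arc)
next
  case (step y z)
  then show ?case using flow_arc[OF step.hyps(2)] flow_add by blast
qed

text \<open>A directed cycle yields a nonzero circulation, which is the difference across edges of its winding numbers \<open>w\<close>;
these vanish outside the grid. They are nonpositive by the escape argument above, and nonnegative by the same argument
in the grid turned by a half turn. So the circulation would be zero.\<close>

lemma acyclic_orient:
  assumes up: "\<And>i j. \<lbrakk>(i, j) \<in> v_edges k l; \<not> d i j\<rbrakk> \<Longrightarrow>
      1 < j \<and> j < l \<and> r i (j - 1) = r (i + 1) (j - 1) \<and> r i j = r (i + 1) j"
  shows "acyclic (orient k l r d)"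
  unfolding acyclic_def
proof (intro allI notI)
  fix x assume "(x, x) \<in> (orient k l r d)\<^sup>+"
  then obtain H V where fl: "flow k l r d x x H V" using flow_path by blast
  have H0: "(i, j) \<notin> h_edges k l \<Longrightarrow> H i j = 0" and V0: "(i, j) \<notin> v_edges k l \<Longrightarrow> V i j = 0"
    and Hs: "r i j \<Longrightarrow> 0 \<le> H i j" "\<not> r i j \<Longrightarrow> H i j \<le> 0"
    and Vs: "d i j \<Longrightarrow> 0 \<le> V i j" for i j
    using fl unfolding flow_def by metis+
  have div: "H i j - H i (j - 1) + V i j - V (i - 1) j = 0" if "1 \<le> i" "1 \<le> j" for i j
    using fl that unfolding flow_def by simp
  define w where "w i j = - (\<Sum>a = 1..i. H a j)" for i j
  have w0: "w 0 j = 0" "w i 0 = 0" "w i l = 0" for i j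
    unfolding w_def using H0 by (auto simp: h_edges_def)
  have w_H: "w i j - w (i - 1) j = - H i j" if "1 \<le> i" for i j
    using that by (cases i) (auto simp: w_def)
  \<comment> \<open>The jump across a vertical edge, by conservation at the vertices of rows 1 to \<open>i\<close>.\<close>
  have w_V: "w i j - w i (j - 1) = V i j" if "1 \<le> j" for i j
  proof (induction i)
    case 0
    then show ?case using w0 V0[of 0 j] by (simp add: v_edges_def)
  next
    case (Suc i)
    then show ?case
      using w_H[of "Suc i" j] w_H[of "Suc i" "j - 1"] div[of "Suc i" j] that by simp
  qed
  have wk: "w k j = 0" for j
  proof (induction j)
    case (Suc j)
    then show ?case using w_V[of "Suc j" k] V0[of k "Suc j"] by (simp add: v_edges_def)
  qed (use w0 in simp)
  have nonpos: "w i j \<le> 0" if "i \<le> k" "1 \<le> j" "j \<le> l" for i j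
  proof (rule winding_nonpos[where k = k and l = l and up = "\<lambda>i j. \<not> d i j" and h = r])
    fix i j assume "1 \<le> i" "i < k" "1 \<le> j" "j < l"
    then show "\<not> \<not> d i (j + 1) \<Longrightarrow> w i j \<le> w i (j + 1)"
      using w_V[of "j + 1" i] Vs[of i "j + 1"] by simp
    assume "\<not> d i (j + 1)"
    then show "r i j = r (i + 1) j"
      using up[of i "j + 1"] \<open>1 \<le> i\<close> \<open>i < k\<close> \<open>1 \<le> j\<close> \<open>j < l\<close> by (simp add: v_edges_def)
  next
    fix i j :: nat assume "1 \<le> i"
    then show "r i j \<Longrightarrow> w i j \<le> w (i - 1) j" "\<not> r i j \<Longrightarrow> w (i - 1) j \<le> w i j"
      using w_H[of i j] Hs[of i j] by linarith+
  qed (use that w0 wk in auto)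
  have nonneg: "0 \<le> w i j" if "i \<le> k" "1 \<le> j" "j < l" for i j
  proof -
    have "- w (k - i) (l - j) \<le> 0" if "i \<le> k" "1 \<le> j" "j \<le> l" for i j
    proof (rule winding_nonpos[where k = k and l = l and up = "\<lambda>i j. \<not> d (k - i) (l + 1 - j)"
        and h = "\<lambda>i j. r (k + 1 - i) (l - j)" and w = "\<lambda>i j. - w (k - i) (l - j)"])
      fix i j assume ij: "1 \<le> i" "i < k" "1 \<le> j" "j < l"
      then have "1 \<le> l - j" "1 \<le> k - i" by auto
      then show "\<not> \<not> d (k - i) (l + 1 - (j + 1)) \<Longrightarrow> - w (k - i) (l - j) \<le> - w (k - i) (l - (j + 1))"
        using w_V[of "l - j" "k - i"] Vs[of "k - i" "l - j"] by simp
      assume "\<not> d (k - i) (l + 1 - (j + 1))"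
      then show "r (k + 1 - i) (l - j) = r (k + 1 - (i + 1)) (l - j)"
        using up[of "k - i" "l - j"] ij \<open>1 \<le> l - j\<close> \<open>1 \<le> k - i\<close> by (simp add: v_edges_def Suc_diff_le)
    next
      fix i j assume ij: "1 \<le> i" "i \<le> k" "1 \<le> j" "j < l"
      then have "k - (i - 1) = k + 1 - i" "k + 1 - i - 1 = k - i" "1 \<le> k + 1 - i" by auto
      then show "r (k + 1 - i) (l - j) \<Longrightarrow> - w (k - i) (l - j) \<le> - w (k - (i - 1)) (l - j)"
        "\<not> r (k + 1 - i) (l - j) \<Longrightarrow> - w (k - (i - 1)) (l - j) \<le> - w (k - i) (l - j)"
        using w_H[of "k + 1 - i" "l - j"] Hs[of "k + 1 - i" "l - j"] ij by auto
    qed (use that w0 wk in auto)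
    from this[of "k - i" "l - j"] show ?thesis using that by simp
  qed
  have w: "w i j = 0" if ij: "i \<le> k" "j \<le> l" for i j
  proof -
    consider "j = 0" | "j = l" | "1 \<le> j" "j < l" using ij by linarith
    then show ?thesis
      using w0 nonpos[OF ij(1)] nonneg[OF ij(1)] by cases (auto intro: order_antisym)
  qed
  have "H i j = 0" for i j
    using w_H[of i j] w[of i j] w[of "i - 1" j] H0[of i j] by (fastforce simp: h_edges_def)
  moreover have "V i j = 0" for i j
    using w_V[of j i] w[of i j] w[of i "j - 1"] V0[of i j] by (fastforce simp: v_edges_def)
  ultimately show False using fl unfolding flow_def by blast
qed

text \<open>An upward edge takes away an entering arc from its lower end and a leaving arc from its upper end, but the two parallel
horizontal edges at each end provide replacements.\<close>

lemma bipolar_orient: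
  assumes kl: "2 \<le> k" "2 \<le> l"
    and first: "\<And>j. r 1 j"
    and last: "t = (k, l) \<and> (\<forall>j. r k j) \<or> t = (k, 1) \<and> (\<forall>j. \<not> r k j)"
    and up: "\<And>i j. \<lbrakk>(i, j) \<in> v_edges k l; \<not> d i j\<rbrakk> \<Longrightarrow>
      1 < j \<and> j < l \<and> r i (j - 1) = r i j \<and> r (i + 1) (j - 1) = r i j \<and> r (i + 1) j = r i j"
  shows "bipolar_orientation (grid k l) (1, 1) t (orient k l r d)"
proof -
  have upE: "d i j \<or> 1 < j \<and> j < l \<and> r i (j - 1) = r i j \<and> r (i + 1) (j - 1) = r i j \<and> r (i + 1) j = r i j"
    if "1 \<le> i" "i < k" "1 \<le> j" "j \<le> l" for i j
    using up[of i j] that by (auto simp: v_edges_def)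
  have ac: "acyclic (orient k l r d)"
    by (rule acyclic_orient) (use up in metis)
  have src: "in_arc k l r d i j \<longleftrightarrow> (i, j) \<noteq> (1, 1)" if "1 \<le> i" "i \<le> k" "1 \<le> j" "j \<le> l" for i j
  proof (cases "i = 1")
    case True
    then show ?thesis
      using that kl first[of "j - 1"] first[of j] upE[of 1 j] by (auto simp: in_arc_def)
  next
    case False
    then have "i - 1 + 1 = i" "1 \<le> i - 1" "i - 1 < k" using that by auto
    then show ?thesis
      using False that upE[of "i - 1" j] by (auto simp: in_arc_def)
  qed
  have snk: "out_arc k l r d i j \<longleftrightarrow> (i, j) \<noteq> t" if "1 \<le> i" "i \<le> k" "1 \<le> j" "j \<le> l" for i j
  proof (cases "i = k")
    case True
    have "k - 1 + 1 = k" "1 \<le> k - 1" "k - 1 < k" using kl by auto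
    then show ?thesis
      using True that kl last upE[of "k - 1" j] by (auto simp: out_arc_def)
  next
    case False
    then show ?thesis
      using that last upE[of i j] by (auto simp: out_arc_def)
  qed
  have t: "t \<in> verts (grid k l)" using last kl by (auto simp: verts_grid)
  have "sources (grid k l) (orient k l r d) = {(1, 1)}"
    unfolding sources_def using src in_arc_iff kl by (fastforce simp: verts_grid)
  moreover have "sinks (grid k l) (orient k l r d) = {t}"
  proof (rule set_eqI)
    fix v :: "nat \<times> nat"
    obtain i j where v: "v = (i, j)" by (cases v)
    show "v \<in> sinks (grid k l) (orient k l r d) \<longleftrightarrow> v \<in> {t}"
    proof (cases "v \<in> verts (grid k l)")
      case True
      then have "(i, j) \<in> verts (grid k l)" unfolding v .
      then have "(\<exists>w. (v, w) \<in> orient k l r d) \<longleftrightarrow> v \<noteq> t"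
        using snk[of i j] out_arc_iff[of i j k l r d] unfolding v verts_grid by blast
      then show ?thesis using True unfolding sinks_def by blast
    next
      case False
      then show ?thesis using t unfolding sinks_def by blast
    qed
  qed
  ultimately show ?thesis
    unfolding bipolar_orientation_def using orient_is_orientation ac by blast
qed

section \<open>The lower bound\<close>

text \<open>Jensen's inequality for \<open>2\<^sup>n\<close>, obtained by summing the tangent inequality at the mean.\<close>

lemma sum_power2_ge_power2_mean:
  fixes f :: "'a \<Rightarrow> nat"
  assumes "(\<Sum>a\<in>I. real (f a)) = real (card I) * \<mu>"
  shows "real (card I) * 2 powr \<mu> \<le> (\<Sum>a\<in>I. 2 ^ f a)"
proof -
  have tangent: "2 powr \<mu> * (1 + (real n - \<mu>) * ln 2) \<le> 2 ^ n" for n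
  proof -
    have "(2::real) ^ n = 2 powr \<mu> * 2 powr (real n - \<mu>)"
      by (simp add: powr_realpow flip: powr_add)
    also have "2 powr (real n - \<mu>) = exp ((real n - \<mu>) * ln 2)"
      by (simp add: powr_def)
    finally show ?thesis
      using exp_ge_add_one_self[of "(real n - \<mu>) * ln 2"] by simp
  qed
  have "(\<Sum>a\<in>I. real (f a) - \<mu>) = 0" using assms by (simp add: sum_subtractf)
  then have "(\<Sum>a\<in>I. 2 powr \<mu> * (1 + (real (f a) - \<mu>) * ln 2)) = real (card I) * 2 powr \<mu>"
    by (simp add: sum.distrib distrib_left flip: sum_distrib_left sum_distrib_right)
  then show ?thesis using sum_mono[of I, OF tangent] by metis
qed

lemma card_constant_on:
  assumes "finite S" "Q \<subseteq> S" "Q \<noteq> {}"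
  shows "card {A \<in> Pow S. Q \<subseteq> A \<or> Q \<inter> A = {}} = 2 * 2 ^ (card S - card Q)"
proof -
  have card_Pow': "card (Pow (S - Q)) = 2 ^ (card S - card Q)"
    using assms by (simp add: card_Pow card_Diff_subset finite_subset)
  have "{A \<in> Pow S. Q \<subseteq> A \<or> Q \<inter> A = {}} = (\<union>) Q ` Pow (S - Q) \<union> Pow (S - Q)" (is "_ = ?X \<union> ?Y")
  proof (rule set_eqI)
    fix A show "A \<in> {A \<in> Pow S. Q \<subseteq> A \<or> Q \<inter> A = {}} \<longleftrightarrow> A \<in> ?X \<union> ?Y"
    proof (cases "Q \<subseteq> A")
      case True
      then have "A = Q \<union> (A - Q)" by auto
      then show ?thesis using True assms by (auto intro: rev_image_eqI[of "A - Q"])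
    next
      case False
      then show ?thesis by auto
    qed
  qed
  moreover have "?X \<inter> ?Y = {}" using assms by auto
  moreover have "card ?X = card ?Y" by (rule card_image) (auto simp: inj_on_def)
  ultimately show ?thesis using card_Pow' assms by (simp add: card_Un_disjoint)
qed

text \<open>The four horizontal edges that meet the vertical edge from \<open>(i, j)\<close> to \<open>(i + 1, j)\<close>,
named by their left ends.\<close>

definition side_edges :: "nat \<times> nat \<Rightarrow> (nat \<times> nat) set" where
  "side_edges = (\<lambda>(i, j). {(i, j - 1), (i, j), (i + 1, j - 1), (i + 1, j)})"

text \<open>The vertical edges that may point up when \<open>A\<close> is the set of horizontal edges pointing right in the rows strictly
between the first and the last. The ranges keep the four adjacent edges within these rows.\<close>

definition flippable :: "nat \<Rightarrow> nat \<Rightarrow> (nat \<times> nat) set \<Rightarrow> (nat \<times> nat) set" where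
  "flippable k l A = {p \<in> {2..<k - 1} \<times> {2..<l}. side_edges p \<subseteq> A \<or> side_edges p \<inter> A = {}}"

text \<open>Four independent random bits agree with probability \<open>1 / 8\<close>.\<close>

lemma sum_card_flippable:
  fixes k l :: nat
  defines "S \<equiv> {2..<k} \<times> {1..<l}"
  shows "(\<Sum>A\<in>Pow S. real (card (flippable k l A))) = real (card (Pow S)) * (real ((k - 3) * (l - 2)) / 8)"
proof -
  let ?R = "{2..<k - 1} \<times> {2..<l}"
  have fin: "finite S" unfolding S_def by simp
  have "8 * card {A \<in> Pow S. side_edges p \<subseteq> A \<or> side_edges p \<inter> A = {}} = card (Pow S)" if "p \<in> ?R" for p
  proof -
    have Q: "side_edges p \<subseteq> S" "card (side_edges p) = 4" using that by (auto simp: side_edges_def S_def)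
    then have "4 \<le> card S" using card_mono[OF fin] by metis
    then have "card (Pow S) = 2 ^ 4 * 2 ^ (card S - 4)"
      using power_add[of "2 :: nat" 4 "card S - 4"] by (simp add: card_Pow[OF fin])
    moreover have "side_edges p \<noteq> {}" using Q by auto
    ultimately show ?thesis using card_constant_on[OF fin Q(1)] Q(2) by simp
  qed
  then have prob: "real (card {A \<in> Pow S. side_edges p \<subseteq> A \<or> side_edges p \<inter> A = {}}) = real (card (Pow S)) / 8" if "p \<in> ?R" for p
    using that by fastforce
  have card_filter: "real (card {p \<in> R. P p}) = (\<Sum>p\<in>R. of_bool (P p))" if "finite R"
    for R :: "'b set" and P
    using that by (simp add: Int_def)
  have "(\<Sum>A\<in>Pow S. real (card (flippable k l A))) =
      (\<Sum>A\<in>Pow S. \<Sum>p\<in>?R. of_bool (side_edges p \<subseteq> A \<or> side_edges p \<inter> A = {}))"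
    unfolding flippable_def by (subst card_filter) simp_all
  also have "\<dots> = (\<Sum>p\<in>?R. \<Sum>A\<in>Pow S. of_bool (side_edges p \<subseteq> A \<or> side_edges p \<inter> A = {}))"
    by (rule sum.swap)
  also have "\<dots> = (\<Sum>p\<in>?R. real (card {A \<in> Pow S. side_edges p \<subseteq> A \<or> side_edges p \<inter> A = {}}))"
    by (subst card_filter) (use fin in simp_all)
  also have "\<dots> = (\<Sum>p\<in>?R. real (card (Pow S)) / 8)"
    by (rule sum.cong) (use prob in auto)
  also have "\<dots> = real (card (Pow S)) * (real ((k - 3) * (l - 2)) / 8)"
    by (simp add: card_cartesian_product numeral_3_eq_3)
  finally show ?thesis .
qed

text \<open>The first row points right and the last row points towards the sink; all other horizontal edges are arbitrary, and any set
\<open>W\<close> of flippable vertical edges points up. These orientations are bipolar for either parity of \<open>k\<close>.\<close>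

lemma card_grid_ge_flips:
  assumes kl: "2 \<le> k" "2 \<le> l"
  shows "(\<Sum>A\<in>Pow ({2..<k} \<times> {1..<l}). 2 ^ card (flippable k l A)) \<le> card (grid_bipolar_orientations k l)"
proof -
  let ?S = "{2..<k} \<times> {1..<l}"
  define r where "r A i j \<longleftrightarrow> i = 1 \<or> (i, j) \<in> A \<or> i = k \<and> odd k" for A :: "(nat \<times> nat) set" and i j
  let ?Z = "SIGMA A:Pow ?S. Pow (flippable k l A)"
  let ?f = "\<lambda>(A, W). orient k l (r A) (\<lambda>i j. (i, j) \<notin> W)"
  have sub: "flippable k l A \<subseteq> {2..<k - 1} \<times> {2..<l}" for A by (auto simp: flippable_def)
  have "inj_on ?f ?Z"
  proof (rule inj_onI, clarify)
    fix A W A' W' assume A: "A \<subseteq> ?S" "W \<subseteq> flippable k l A" "A' \<subseteq> ?S" "W' \<subseteq> flippable k l A'"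
      and eq: "orient k l (r A) (\<lambda>i j. (i, j) \<notin> W) = orient k l (r A') (\<lambda>i j. (i, j) \<notin> W')"
    have "(i, j) \<in> A \<longleftrightarrow> (i, j) \<in> A'" if "(i, j) \<in> ?S" for i j
    proof -
      have "((i, j), (i, Suc j)) \<in> orient k l (r A) (\<lambda>i j. (i, j) \<notin> W) \<longleftrightarrow>
            ((i, j), (i, Suc j)) \<in> orient k l (r A') (\<lambda>i j. (i, j) \<notin> W')" unfolding eq ..
      then show ?thesis using that by (auto simp: mem_orient h_edges_def r_def)
    qed
    moreover have "(i, j) \<in> W \<longleftrightarrow> (i, j) \<in> W'" if "(i, j) \<in> {2..<k - 1} \<times> {2..<l}" for i j
    proof -
      have "((i, j), (Suc i, j)) \<in> orient k l (r A) (\<lambda>i j. (i, j) \<notin> W) \<longleftrightarrow>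
            ((i, j), (Suc i, j)) \<in> orient k l (r A') (\<lambda>i j. (i, j) \<notin> W')" unfolding eq ..
      then show ?thesis using that by (auto simp: mem_orient v_edges_def)
    qed
    ultimately show "A = A' \<and> W = W'" using A sub by (intro conjI; fast)
  qed
  moreover have "?f ` ?Z \<subseteq> grid_bipolar_orientations k l"
  proof clarify
    fix A W assume A: "A \<subseteq> ?S" and W: "W \<subseteq> flippable k l A"
    show "orient k l (r A) (\<lambda>i j. (i, j) \<notin> W) \<in> grid_bipolar_orientations k l"
      unfolding grid_bipolar_orientations_def mem_Collect_eq
    proof (rule bipolar_orient[OF kl])
      show "r A 1 j" for j by (simp add: r_def)
      show "grid_sink k l = (k, l) \<and> (\<forall>j. r A k j) \<or> grid_sink k l = (k, 1) \<and> (\<forall>j. \<not> r A k j)"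
        using A kl by (auto simp: grid_sink_def r_def)
    next
      fix i j assume "\<not> (i, j) \<notin> W"
      then have "(i, j) \<in> flippable k l A" using W by auto
      then show "1 < j \<and> j < l \<and> r A i (j - 1) = r A i j \<and> r A (i + 1) (j - 1) = r A i j \<and>
          r A (i + 1) j = r A i j"
        unfolding flippable_def r_def side_edges_def by auto
    qed
  qed
  ultimately have "card ?Z \<le> card (grid_bipolar_orientations k l)"
    by (rule card_inj_on_le) (rule finite_grid_bipolar_orientations)
  moreover have "card ?Z = (\<Sum>A\<in>Pow ?S. 2 ^ card (flippable k l A))"
    using finite_subset[OF sub] by (simp add: card_SigmaI card_Pow)
  ultimately show ?thesis by simp
qed

text \<open>There are \<open>(k - 2) (l - 1)\<close> arbitrary horizontal edges and on average \<open>(k - 3) (l - 2) / 8\<close> flippable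
vertical ones, together \<open>9 / 8 k l\<close> up to a multiple of \<open>k + l\<close>.\<close>

lemma card_grid_lower:
  assumes kl: "3 \<le> k" "3 \<le> l"
  shows "(2 powr (9 / 8)) ^ (k * l) \<le> 16 ^ (k + l) * real (card (grid_bipolar_orientations k l))"
proof -
  let ?S = "{2..<k} \<times> {1..<l}"
  let ?e = "real (card ?S) + real ((k - 3) * (l - 2)) / 8"
  have "2 powr real (card ?S) = real (card (Pow ?S))"
    by (subst powr_realpow, simp, subst card_Pow) simp_all
  then have "2 powr ?e = real (card (Pow ?S)) * 2 powr (real ((k - 3) * (l - 2)) / 8)"
    by (simp only: powr_add)
  also have "\<dots> \<le> (\<Sum>A\<in>Pow ?S. 2 ^ card (flippable k l A))"
    by (rule sum_power2_ge_power2_mean) (rule sum_card_flippable)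
  also have "\<dots> \<le> real (card (grid_bipolar_orientations k l))"
    using of_nat_mono[OF card_grid_ge_flips[of k l], where 'a = real] kl by simp
  finally have *: "2 powr ?e \<le> real (card (grid_bipolar_orientations k l))" .
  have "real (card ?S) = (real k - 2) * (real l - 1)" "real ((k - 3) * (l - 2)) = (real k - 3) * (real l - 2)"
    using kl by (auto simp: card_cartesian_product)
  then have "9 / 8 * real (k * l) \<le> 4 * real (k + l) + ?e"
    by (simp add: algebra_simps)
  then have exponents: "real (k * l) * (9 / 8) \<le> real (4 * (k + l)) + ?e" by simp
  have "(2 powr (9 / 8)) ^ (k * l) = 2 powr (real (k * l) * (9 / 8))"
    by (rule powr_power) simp
  also have "\<dots> \<le> 2 powr (real (4 * (k + l)) + ?e)"
    by (rule powr_mono[OF exponents]) simp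
  also have "\<dots> = 2 ^ (4 * (k + l)) * 2 powr ?e"
    unfolding powr_add by (subst powr_realpow) simp_all
  also have "\<dots> = 16 ^ (k + l) * 2 powr ?e"
    unfolding power_mult by simp
  also have "\<dots> \<le> 16 ^ (k + l) * real (card (grid_bipolar_orientations k l))"
    using * by (rule mult_left_mono) simp
  finally show ?thesis .
qed

section \<open>Comparison with the two constants\<close>

text \<open>For \<open>k\<close> and \<open>l\<close> both large, the area \<open>k l\<close> exceeds any fixed multiple of \<open>k + l\<close>.\<close>

lemma boundary_factor_absorbed:
  fixes a c :: real
  assumes a: "1 < a" and c: "1 \<le> c"
  shows "\<exists>N. \<forall>k l. N \<le> k \<longrightarrow> N \<le> l \<longrightarrow> c ^ (k + l) \<le> a ^ (k * l)"
proof -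
  obtain M where M: "c < a ^ M" using real_arch_pow[OF a] by blast
  have "c ^ (k + l) \<le> a ^ (k * l)" if "2 * M \<le> k" "2 * M \<le> l" for k l
  proof -
    have "2 * (M * (k + l)) = 2 * M * l + 2 * M * k" by (simp add: algebra_simps)
    also have "\<dots> \<le> k * l + l * k" using that by (intro add_mono mult_le_mono1)
    also have "\<dots> = 2 * (k * l)" by simp
    finally have "M * (k + l) \<le> k * l" by simp
    have "c ^ (k + l) \<le> (a ^ M) ^ (k + l)" using M c by (intro power_mono) auto
    also have "\<dots> = a ^ (M * (k + l))" by (simp add: power_mult)
    also have "\<dots> \<le> a ^ (k * l)"
      using \<open>M * (k + l) \<le> k * l\<close> a by (intro power_increasing) auto
    finally show ?thesis .
  qed
  then show ?thesis by blast
qed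

theorem theorem10:
  "\<exists>N. \<forall>k l. N \<le> k \<longrightarrow> N \<le> l \<longrightarrow>
     (2.18 :: real) ^ (k * l) \<le> real (card (grid_bipolar_orientations k l)) \<and>
     real (card (grid_bipolar_orientations k l)) \<le> (2.619 :: real) ^ (k * l)"
proof -
  \<comment> \<open>Just above the golden ratio 1.61803..., with room below the square root of 2.619.\<close>
  define x :: real where "x = 1.6182"
  \<comment> \<open>About 2.181: one bit for each horizontal edge and an eighth of a bit for each vertical edge.\<close>
  define y :: real where "y = 2 powr (9 / 8)"
  have x: "1 \<le> x" "x \<le> 2" "x + 1 \<le> x\<^sup>2" "0 < x\<^sup>2" "x\<^sup>2 < 2.619"
    by (simp_all add: x_def power2_eq_square)
  have "y ^ 8 = 2 ^ 9" by (simp add: y_def powr_power)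
  then have "(2.18 :: real) ^ 8 < y ^ 8" by (simp add: power_divide)
  then have y: "2.18 < y" by (rule power_less_imp_less_base) (simp add: y_def)
  obtain N1 where N1: "16 ^ (k + l) \<le> (2.619 / x\<^sup>2) ^ (k * l)" if "N1 \<le> k" "N1 \<le> l" for k l
    using boundary_factor_absorbed[of "2.619 / x\<^sup>2" 16] x by auto
  obtain N2 where N2: "16 ^ (k + l) \<le> (y / 2.18) ^ (k * l)" if "N2 \<le> k" "N2 \<le> l" for k l
    using boundary_factor_absorbed[of "y / 2.18" 16] y by auto
  show ?thesis
  proof (intro exI[of _ "max 3 (max N1 N2)"] allI impI conjI)
    fix k l assume kl: "max 3 (max N1 N2) \<le> k" "max 3 (max N1 N2) \<le> l"
    let ?B = "real (card (grid_bipolar_orientations k l))"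
    have "?B \<le> 16 ^ (k + l) * (x\<^sup>2) ^ (k * l)"
      using kl x by (intro card_grid_upper) auto
    also have "\<dots> \<le> (2.619 / x\<^sup>2) ^ (k * l) * (x\<^sup>2) ^ (k * l)"
      using kl x by (intro mult_right_mono N1) auto
    also have "\<dots> = 2.619 ^ (k * l)" using x by (simp flip: power_mult_distrib)
    finally show "?B \<le> 2.619 ^ (k * l)" .
    have "16 ^ (k + l) * 2.18 ^ (k * l) \<le> (y / 2.18) ^ (k * l) * 2.18 ^ (k * l)"
      using kl by (intro mult_right_mono N2) auto
    also have "\<dots> = y ^ (k * l)" by (simp flip: power_mult_distrib)
    also have "\<dots> \<le> 16 ^ (k + l) * ?B"
      unfolding y_def using kl by (intro card_grid_lower) auto
    finally show "2.18 ^ (k * l) \<le> ?B" by simp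
  qed
qed

end
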